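(* Let $F=\{f_i\}_{i=1}^\infty$ be a frame for a Hilbert space $\mathcal{H}$ and let $m\ge1$ be an integer. Then $F$ has excess $m$ if and only if for every subset $\Lambda\subset\mathbb{N}$ with $|\Lambda|=m$, the family $\{f_i\}_{i\in\mathbb{N}\setminus\Lambda}$ is also a frame for $\mathcal{H}$.
   Context: A sequence $\{f_i\}_{i\in I}$ in a Hilbert space $\mathcal{H}$ ($I$ countable) is a frame for $\mathcal{H}$ if there are constants $A,B>0$ with $A\|f\|^2\le\sum_{i\in I}|\langle f,f_i\rangle|^2\le B\|f\|^2$ for all $f\in\mathcal{H}$. In this statement, a frame $F=\{f_i\}_{i=1}^\infty$ is said to have excess $m$ if for every subset $\Lambda\subset\mathbb{N}$ with $|\Lambda|=m$ there are scalars $a_{ij}$ ($i\in\Lambda$, $j\notin\Lambda$) such that $f_i=\sum_{j\notin\Lambda}a_{ij}f_j$ (norm-convergent series) for all $i\in\Lambda$. *)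

theory Defs
  imports "HOL-Analysis.Analysis"
begin

text \<open>
  Hilbert spaces are treated over the reals and over the complex numbers at once.  The
  class below axiomatises the scalar field with its conjugation.  Both fields are instances,
  and up to isomorphism they are the only ones: a real normed field is isomorphic to one
  of the two by Gelfand--Mazur, and the last axiom forces the usual conjugation.
\<close>

class rc_field = real_normed_field +
  fixes conjugate :: "'a \<Rightarrow> 'a"
  assumes conjugate_add: "conjugate (x + y) = conjugate x + conjugate y"
    and conjugate_mult: "conjugate (x * y) = conjugate x * conjugate y"
    and mult_conjugate: "x * conjugate x = ((norm x)\<^sup>2) *\<^sub>R 1"

instantiation real :: rc_field
begin
definition conjugate_real :: "real \<Rightarrow> real" where "conjugate_real x = x"
instance
  by standard (simp_all add: conjugate_real_def power2_eq_square)
end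

instantiation complex :: rc_field
begin
definition conjugate_complex :: "complex \<Rightarrow> complex" where "conjugate_complex = cnj"
instance
  by standard (simp_all add: conjugate_complex_def complex_norm_square scaleR_conv_of_real del: of_real_power)
end

text \<open>
  The inner product is linear in its first argument.  Its norm is required to be the norm of
  the type, so completeness is provided by the class \<open>banach\<close>.
\<close>

locale hilbert_space = vector_space smul
  for smul :: "'k::rc_field \<Rightarrow> 'h::banach \<Rightarrow> 'h" +
  fixes ip :: "'h \<Rightarrow> 'h \<Rightarrow> 'k"
  assumes smul_of_real: "smul (of_real r) x = r *\<^sub>R x"
    and ip_add_left: "ip (x + y) z = ip x z + ip y z"
    and ip_smul_left: "ip (smul c x) y = c * ip x y"
    and ip_commute: "ip y x = conjugate (ip x y)"
    and ip_self: "ip x x = of_real ((norm x)\<^sup>2)"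

lemma hilbert_space_real:
  "hilbert_space (scaleR :: real \<Rightarrow> 'h \<Rightarrow> 'h::{real_inner, banach}) inner"
  by unfold_locales
    (simp_all add: conjugate_real_def inner_add_left inner_commute power2_norm_eq_inner algebra_simps)

lemma hilbert_space_complex:
  "hilbert_space ((*) :: complex \<Rightarrow> complex \<Rightarrow> complex) (\<lambda>x y. x * cnj y)"
  by unfold_locales
    (simp_all add: conjugate_complex_def complex_norm_square scaleR_conv_of_real algebra_simps
      del: of_real_power)

definition is_frame ::
    "('h::banach \<Rightarrow> 'h \<Rightarrow> 'k::rc_field) \<Rightarrow> 'i set \<Rightarrow> ('i \<Rightarrow> 'h) \<Rightarrow> bool" where
  "is_frame ip I f \<longleftrightarrow> countable I \<and>
     (\<exists>A>0. \<exists>B>0. \<forall>g. (\<lambda>i. (norm (ip g (f i)))\<^sup>2) summable_on I \<and>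
        A * (norm g)\<^sup>2 \<le> (\<Sum>\<^sub>\<infinity>i\<in>I. (norm (ip g (f i)))\<^sup>2) \<and>
        (\<Sum>\<^sub>\<infinity>i\<in>I. (norm (ip g (f i)))\<^sup>2) \<le> B * (norm g)\<^sup>2)"

text \<open>
  The series over the complement of \<open>\<Lambda>\<close> is an ordinary norm-convergent series, taken in the
  natural order of the indices (it is not required to converge unconditionally); padding
  it with zeros at the indices in \<open>\<Lambda>\<close> does not change convergence or the sum.
\<close>

definition has_excess ::
    "('k::rc_field \<Rightarrow> 'h::banach \<Rightarrow> 'h) \<Rightarrow> (nat \<Rightarrow> 'h) \<Rightarrow> nat \<Rightarrow> bool" where
  "has_excess smul f m \<longleftrightarrow>
     (\<forall>\<Lambda>. finite \<Lambda> \<and> card \<Lambda> = m \<longrightarrow>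
        (\<exists>a. \<forall>i\<in>\<Lambda>. (\<lambda>j. if j \<in> \<Lambda> then 0 else smul (a i j) (f j)) sums f i))"

end

theory Submission imports Defs
begin

text \<open>
  If \<open>{f\<^sub>j}\<close> with \<open>j \<notin> \<Lambda>\<close> is a frame, its frame operator \<open>S\<close> is onto: for a Bessel bound \<open>B\<close>
  and a lower bound \<open>A\<close>, the map \<open>h \<mapsto> h - B\<^sup>-\<^sup>1 (S h - y)\<close> is a contraction with constant
  \<open>\<surd>(1 - A / B)\<close>, and its fixed point \<open>h\<close> gives \<open>y = \<Sum> \<langle>h, f\<^sub>j\<rangle> f\<^sub>j\<close>.

  Conversely, the expansions of the removed vectors show that the remaining ones are still
  total.  Removing a single vector \<open>f\<^sub>i\<close> from a frame so that the rest is total leaves a frame: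
  otherwise there are \<open>h\<^sub>n\<close> with \<open>\<langle>h\<^sub>n, f\<^sub>i\<rangle> = 1\<close> whose remaining coefficients tend to \<open>0\<close> in
  \<open>\<ell>\<^sup>2\<close>; by the lower frame bound they form a Cauchy sequence, and the limit is a nonzero vector
  orthogonal to the rest.  Removing the elements of \<open>\<Lambda>\<close> one by one avoids any compactness of
  the scalar field.
\<close>

context hilbert_space
begin

subsection \<open>The inner product\<close>

lemma ip_scaleR_left: "ip (r *\<^sub>R x) y = r *\<^sub>R ip x y"
  by (metis smul_of_real ip_smul_left scaleR_conv_of_real)

lemma ip_zero_left [simp]: "ip 0 y = 0"
  using ip_add_left[of 0 0 y] by simp

lemma conjugate_zero [simp]: "conjugate (0::'k) = 0"
  using conjugate_add[of "0::'k" 0] by simp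

lemma norm_conjugate [simp]: "norm (conjugate (x::'k)) = norm x"
proof (cases "x = 0")
  case False
  have "norm (x * conjugate x) = (norm x)\<^sup>2"
    by (simp add: mult_conjugate)
  then show ?thesis
    using False by (simp add: norm_mult power2_eq_square)
qed simp

text \<open>Real-linearity of conjugation is not an axiom of the class; cancelling
  \<open>of_real r\<close> in \<open>mult_conjugate\<close> recovers it.\<close>

lemma conjugate_of_real [simp]: "conjugate (of_real r :: 'k) = of_real r"
proof (cases "r = 0")
  case False
  have "(of_real r :: 'k) * conjugate (of_real r) = of_real r * of_real r"
    by (simp add: mult_conjugate scaleR_conv_of_real power2_eq_square abs_mult_self_eq
        flip: of_real_mult)
  then show ?thesis
    using False by simp
qed simp

lemma ip_add_right: "ip z (x + y) = ip z x + ip z y"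
  by (metis ip_add_left ip_commute conjugate_add)

lemma ip_smul_right: "ip x (smul c y) = conjugate c * ip x y"
  by (metis ip_smul_left ip_commute conjugate_mult)

lemma ip_scaleR_right: "ip x (r *\<^sub>R y) = r *\<^sub>R ip x y"
  by (metis smul_of_real ip_smul_right conjugate_of_real scaleR_conv_of_real)

lemma ip_zero_right [simp]: "ip x 0 = 0"
  using ip_add_right[of x 0 0] by simp

lemma ip_diff_left: "ip (x - y) z = ip x z - ip y z"
  using ip_add_left[of "x - y" y z] by simp

lemma ip_diff_right: "ip z (x - y) = ip z x - ip z y"
  using ip_add_right[of z "x - y" y] by simp

section \<open>Norm identities and the Cauchy-Schwarz inequality\<close>

lemma ip_times_commute: "ip x y * ip y x = of_real ((norm (ip x y))\<^sup>2)"
  unfolding ip_commute[where y = y and x = x] by (simp add: mult_conjugate scaleR_conv_of_real)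

text \<open>The abstract field has no real part, so the cross terms are handled only for a real
  inner product. This covers both uses: \<open>v\<close> is \<open>smul (ip x y) y\<close> in
  Cauchy-Schwarz and the image of \<open>u\<close> under the frame operator later.\<close>

lemma norm_diff_scaleR_sq:
  assumes "ip u v = of_real e"
  shows "(norm (u - r *\<^sub>R v))\<^sup>2 = (norm u)\<^sup>2 - 2 * r * e + r\<^sup>2 * (norm v)\<^sup>2"
proof -
  have vu: "ip v u = of_real e"
    by (subst ip_commute) (simp add: assms)
  have "of_real ((norm (u - r *\<^sub>R v))\<^sup>2) = ip (u - r *\<^sub>R v) (u - r *\<^sub>R v)"
    by (simp only: ip_self)
  also have "\<dots> = of_real ((norm u)\<^sup>2) - r *\<^sub>R of_real e - (r *\<^sub>R of_real e - of_real ((norm (r *\<^sub>R v))\<^sup>2))"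
    unfolding ip_diff_left[of u "r *\<^sub>R v" "u - r *\<^sub>R v"]
    by (simp only: ip_diff_right ip_scaleR_left ip_scaleR_right vu assms ip_self)
  also have "\<dots> = (of_real ((norm u)\<^sup>2 - 2 * r * e + r\<^sup>2 * (norm v)\<^sup>2) :: 'k)"
    by (simp add: scaleR_conv_of_real norm_scaleR power_mult_distrib algebra_simps)
  finally show ?thesis
    by (simp only: of_real_eq_iff)
qed

lemma norm_smul: "norm (smul c x) = norm c * norm x"
proof -
  have "ip (smul c x) (smul c x) = (c * conjugate c) * ip x x"
    by (simp add: ip_smul_left ip_smul_right mult.assoc)
  also have "\<dots> = of_real ((norm c * norm x)\<^sup>2)"
    by (simp add: mult_conjugate ip_self scaleR_conv_of_real power_mult_distrib)
  finally have "(norm (smul c x))\<^sup>2 = (norm c * norm x)\<^sup>2"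
    by (simp only: ip_self of_real_eq_iff)
  then show ?thesis
    by simp
qed

text \<open>Subtracting from \<open>x\<close> its projection onto \<open>y\<close> leaves a vector
  of nonnegative squared norm.\<close>

lemma Cauchy_Schwarz: "norm (ip x y) \<le> norm x * norm y"
proof (cases "y = 0")
  case False
  define t where "t = norm (ip x y)"
  have "ip x (smul (ip x y) y) = of_real (t\<^sup>2)"
    by (simp only: ip_smul_right t_def mult.commute[of _ "ip x y"] mult_conjugate scaleR_conv_of_real mult_1_right)
  note norm_diff_scaleR_sq[OF this, of "1 / (norm y)\<^sup>2", symmetric]
  then have "0 \<le> (norm x)\<^sup>2 - 2 * (1 / (norm y)\<^sup>2) * t\<^sup>2 + (1 / (norm y)\<^sup>2)\<^sup>2 * (t * norm y)\<^sup>2"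
    by (simp only: norm_smul t_def zero_le_power2)
  also have "\<dots> = (norm x)\<^sup>2 - t\<^sup>2 / (norm y)\<^sup>2"
    using False by (simp add: field_simps power2_eq_square)
  finally have "t\<^sup>2 \<le> (norm x * norm y)\<^sup>2"
    using False by (simp add: field_simps)
  then show ?thesis
    unfolding t_def by (rule power2_le_imp_le) simp
qed simp

lemma bounded_linear_ip_left: "bounded_linear (\<lambda>x. ip x y)"
  by (rule bounded_linear_intro[where K = "norm y"])
     (simp_all add: ip_add_left ip_scaleR_left Cauchy_Schwarz)

lemma bounded_linear_ip_right: "bounded_linear (ip x)"
  by (rule bounded_linear_intro[where K = "norm x"])
     (simp_all add: ip_add_right ip_scaleR_right Cauchy_Schwarz mult.commute[of _ "norm x"])

lemma ip_sum_right: "ip x (sum g F) = (\<Sum>j\<in>F. ip x (g j))"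
  using bounded_linear_ip_right by (rule linear_sum[OF bounded_linear.linear])

subsection \<open>Frames indexed by the natural numbers\<close>

definition energy :: "(nat \<Rightarrow> 'h) \<Rightarrow> 'h \<Rightarrow> real" where
  "energy f g = (\<Sum>j. (norm (ip g (f j)))\<^sup>2)"

text \<open>Summability is explicit because \<open>energy\<close> is a \<open>suminf\<close>, whose
  value carries no information when the series diverges.\<close>

definition bessel :: "real \<Rightarrow> (nat \<Rightarrow> 'h) \<Rightarrow> bool" where
  "bessel B f \<longleftrightarrow>
    (\<forall>g. summable (\<lambda>j. (norm (ip g (f j)))\<^sup>2) \<and> energy f g \<le> B * (norm g)\<^sup>2)"

definition frame_seq :: "(nat \<Rightarrow> 'h) \<Rightarrow> bool" where
  "frame_seq f \<longleftrightarrow> (\<exists>A>0. \<exists>B>0. bessel B f \<and> (\<forall>g. A * (norm g)\<^sup>2 \<le> energy f g))"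

lemma is_frame_UNIV_iff: "is_frame ip UNIV f \<longleftrightarrow> frame_seq f"
proof -
  have "(\<lambda>i. (norm (ip g (f i)))\<^sup>2) summable_on UNIV \<longleftrightarrow> summable (\<lambda>i. (norm (ip g (f i)))\<^sup>2)"
    for g by (rule summable_on_UNIV_nonneg_real_iff) simp
  moreover have "(\<Sum>\<^sub>\<infinity>i. (norm (ip g (f i)))\<^sup>2) = energy f g"
    if "(\<lambda>i. (norm (ip g (f i)))\<^sup>2) summable_on UNIV" for g
    using has_sum_imp_sums[OF has_sum_infsum[OF that]] by (simp add: energy_def sums_iff)
  ultimately have *: "(\<lambda>i. (norm (ip g (f i)))\<^sup>2) summable_on UNIV \<and>
      A * (norm g)\<^sup>2 \<le> (\<Sum>\<^sub>\<infinity>i. (norm (ip g (f i)))\<^sup>2) \<and>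
      (\<Sum>\<^sub>\<infinity>i. (norm (ip g (f i)))\<^sup>2) \<le> B * (norm g)\<^sup>2 \<longleftrightarrow>
      (summable (\<lambda>i. (norm (ip g (f i)))\<^sup>2) \<and> energy f g \<le> B * (norm g)\<^sup>2) \<and>
      A * (norm g)\<^sup>2 \<le> energy f g" for A B g
    by auto
  show ?thesis
    unfolding is_frame_def frame_seq_def bessel_def * all_conj_distrib by simp
qed

text \<open>Replacing removed vectors by zero leaves all sums unchanged and keeps the index set
  \<open>nat\<close>, so ordinary series can be used throughout.\<close>

lemma is_frame_Compl_iff:
  fixes f :: "nat \<Rightarrow> 'h"
  shows "is_frame ip (UNIV - \<Lambda>) f \<longleftrightarrow> frame_seq (\<lambda>j. if j \<in> \<Lambda> then 0 else f j)"
proof -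
  let ?f = "\<lambda>j. if j \<in> \<Lambda> then 0 else f j"
  have "(\<lambda>i. (norm (ip g (f i)))\<^sup>2) summable_on (UNIV - \<Lambda>)
      \<longleftrightarrow> (\<lambda>i. (norm (ip g (?f i)))\<^sup>2) summable_on UNIV" for g
    by (rule summable_on_cong_neutral) auto
  moreover have "(\<Sum>\<^sub>\<infinity>i\<in>UNIV - \<Lambda>. (norm (ip g (f i)))\<^sup>2) = (\<Sum>\<^sub>\<infinity>i. (norm (ip g (?f i)))\<^sup>2)" for g
    by (rule infsum_cong_neutral) auto
  ultimately have "is_frame ip (UNIV - \<Lambda>) f \<longleftrightarrow> is_frame ip UNIV ?f"
    unfolding is_frame_def by simp
  then show ?thesis
    by (simp only: is_frame_UNIV_iff)
qed

lemma bessel_summable: "bessel B f \<Longrightarrow> summable (\<lambda>j. (norm (ip g (f j)))\<^sup>2)"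
  by (simp add: bessel_def)

lemma bessel_energy_le: "bessel B f \<Longrightarrow> energy f g \<le> B * (norm g)\<^sup>2"
  by (simp add: bessel_def)

lemma sum_le_energy:
  "bessel B f \<Longrightarrow> finite F \<Longrightarrow> (\<Sum>j\<in>F. (norm (ip g (f j)))\<^sup>2) \<le> energy f g"
  unfolding energy_def by (intro sum_le_suminf bessel_summable) auto

subsection \<open>The frame operator\<close>

text \<open>Duality: expand one factor of \<open>ip v v\<close>, apply Cauchy-Schwarz to the
  coefficients, bound the coefficients of \<open>v\<close> by the Bessel inequality, and cancel one
  factor \<open>norm v\<close>.\<close>

lemma bessel_synthesis_bound:
  assumes B: "bessel B f" "B > 0" and "finite F"
  shows "(norm (\<Sum>j\<in>F. smul (c j) (f j)))\<^sup>2 \<le> B * (\<Sum>j\<in>F. (norm (c j))\<^sup>2)"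
proof -
  define v where "v = (\<Sum>j\<in>F. smul (c j) (f j))"
  define N where "N = L2_set (\<lambda>j. norm (c j)) F"
  have "0 \<le> N"
    unfolding N_def by (rule L2_set_nonneg)
  have "(norm v)\<^sup>2 = norm (ip v v)"
    by (simp add: ip_self norm_power)
  also have "ip v v = (\<Sum>j\<in>F. conjugate (c j) * ip v (f j))"
    by (subst (2) v_def) (simp add: ip_sum_right ip_smul_right)
  also have "norm \<dots> \<le> (\<Sum>j\<in>F. \<bar>norm (c j)\<bar> * \<bar>norm (ip v (f j))\<bar>)"
    by (rule order_trans[OF norm_sum]) (simp add: norm_mult)
  also have "\<dots> \<le> N * L2_set (\<lambda>j. norm (ip v (f j))) F"
    unfolding N_def by (rule L2_set_mult_ineq)
  also have "L2_set (\<lambda>j. norm (ip v (f j))) F \<le> sqrt (B * (norm v)\<^sup>2)"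
    unfolding L2_set_def
    using sum_le_energy[OF B(1) \<open>finite F\<close>, of v] bessel_energy_le[OF B(1), of v] by simp
  also have "sqrt (B * (norm v)\<^sup>2) = sqrt B * norm v"
    by (simp add: real_sqrt_mult)
  finally have "norm v * norm v \<le> (N * sqrt B) * norm v"
    using \<open>0 \<le> N\<close> by (simp add: mult_left_mono power2_eq_square mult.assoc)
  moreover have "0 \<le> N * sqrt B"
    using \<open>0 \<le> N\<close> B(2) by simp
  ultimately have "norm v \<le> N * sqrt B"
    by (cases "v = 0") (auto dest: mult_right_le_imp_le)
  then have "(norm v)\<^sup>2 \<le> (N * sqrt B)\<^sup>2"
    by (rule power_mono) simp
  also have "\<dots> = B * (\<Sum>j\<in>F. (norm (c j))\<^sup>2)"
    using B(2) by (simp add: N_def L2_set_def power_mult_distrib sum_nonneg mult.commute)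
  finally show ?thesis
    by (simp add: v_def)
qed

text \<open>The finite bound on blocks of indices transfers the Cauchy criterion from the squared
  coefficients to the vectors.\<close>

lemma bessel_synthesis_summable:
  assumes B: "bessel B f" "B > 0" and c: "summable (\<lambda>j. (norm (c j))\<^sup>2)"
  shows "summable (\<lambda>j. smul (c j) (f j))"
  unfolding summable_Cauchy
proof (intro allI impI)
  fix e :: real assume "e > 0"
  then have "e\<^sup>2 / B > 0"
    using B(2) by simp
  then obtain N where N: "\<And>m n. m \<ge> N \<Longrightarrow> norm (\<Sum>j=m..<n. (norm (c j))\<^sup>2) < e\<^sup>2 / B"
    using c unfolding summable_Cauchy by blast
  have "norm (\<Sum>j=m..<n. smul (c j) (f j)) < e" if "m \<ge> N" for m n
  proof -
    have "(norm (\<Sum>j=m..<n. smul (c j) (f j)))\<^sup>2 \<le> B * (\<Sum>j=m..<n. (norm (c j))\<^sup>2)"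
      by (rule bessel_synthesis_bound[OF B]) simp
    also have "\<dots> < e\<^sup>2"
      using N[OF that, of n] B(2) by (simp add: sum_nonneg pos_less_divide_eq mult.commute)
    finally show ?thesis
      by (rule power2_less_imp_less) (use \<open>e > 0\<close> in simp)
  qed
  then show "\<exists>N. \<forall>m\<ge>N. \<forall>n. norm (\<Sum>j=m..<n. smul (c j) (f j)) < e"
    by blast
qed

lemma norm_bessel_synthesis_sq_le:
  assumes B: "bessel B f" "B > 0" and c: "summable (\<lambda>j. (norm (c j))\<^sup>2)"
  shows "(norm (\<Sum>j. smul (c j) (f j)))\<^sup>2 \<le> B * (\<Sum>j. (norm (c j))\<^sup>2)"
proof (rule LIMSEQ_le)
  show "(\<lambda>n. (norm (\<Sum>j<n. smul (c j) (f j)))\<^sup>2) \<longlonglongrightarrow> (norm (\<Sum>j. smul (c j) (f j)))\<^sup>2"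
    by (rule tendsto_power[OF tendsto_norm[OF summable_LIMSEQ[OF bessel_synthesis_summable[OF assms]]]])
  show "(\<lambda>n. B * (\<Sum>j<n. (norm (c j))\<^sup>2)) \<longlonglongrightarrow> B * (\<Sum>j. (norm (c j))\<^sup>2)"
    by (rule tendsto_mult_left[OF summable_LIMSEQ[OF c]])
  show "\<exists>N. \<forall>n\<ge>N. (norm (\<Sum>j<n. smul (c j) (f j)))\<^sup>2 \<le> B * (\<Sum>j<n. (norm (c j))\<^sup>2)"
    by (simp add: bessel_synthesis_bound[OF B])
qed

lemma frame_seq_expansion:
  assumes "frame_seq f"
  obtains h where "(\<lambda>j. smul (ip h (f j)) (f j)) sums y"
proof -
  obtain A B where AB: "A > 0" "B > 0" and B: "bessel B f"
    and A: "\<And>g. A * (norm g)\<^sup>2 \<le> energy f g"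
    using assms unfolding frame_seq_def by blast
  define S where "S h = (\<Sum>j. smul (ip h (f j)) (f j))" for h
  have summ: "summable (\<lambda>j. smul (ip h (f j)) (f j))" for h
    by (rule bessel_synthesis_summable[OF B AB(2) bessel_summable[OF B]])
  have S_diff: "S h - S k = S (h - k)" for h k
    unfolding S_def
    by (simp add: suminf_diff[OF summ summ] ip_diff_left scale_left_diff_distrib)
  have ip_S: "ip h (S h) = of_real (energy f h)" for h
  proof -
    have "ip h (S h) = (\<Sum>j. ip h (smul (ip h (f j)) (f j)))"
      unfolding S_def by (rule bounded_linear.suminf[OF bounded_linear_ip_right summ])
    also have "\<dots> = (\<Sum>j. of_real ((norm (ip h (f j)))\<^sup>2))"
      by (subst ip_smul_right) (simp only: mult_conjugate mult.commute[of "conjugate _"] scaleR_conv_of_real mult_1_right)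
    also have "\<dots> = of_real (energy f h)"
      unfolding energy_def by (rule suminf_of_real[symmetric, OF bessel_summable[OF B]])
    finally show ?thesis .
  qed
  \<comment> \<open>In the zero space \<open>A\<close> may exceed \<open>B\<close>; the maximum
    keeps \<open>q\<close> nonnegative.\<close>
  define q where "q = sqrt (max 0 (1 - A / B))"
  have contr: "norm (h - (1 / B) *\<^sub>R S h) \<le> q * norm h" for h
  proof -
    have "(norm (S h))\<^sup>2 \<le> B * energy f h"
      unfolding S_def energy_def
      by (rule norm_bessel_synthesis_sq_le[OF B AB(2) bessel_summable[OF B]])
    then have "(1 / B)\<^sup>2 * (norm (S h))\<^sup>2 \<le> energy f h / B"
      using AB by (simp add: field_simps power2_eq_square)
    moreover have "A / B * (norm h)\<^sup>2 \<le> energy f h / B"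
      using A[of h] AB by (simp add: field_simps)
    \<comment> \<open>With \<open>r = 1 / B\<close> the cross term is
      \<open>- 2 * energy f h / B\<close>; the quadratic term takes back at most half of it, and the
      lower frame bound estimates the rest.\<close>
    ultimately have "(norm (h - (1 / B) *\<^sub>R S h))\<^sup>2 \<le> (1 - A / B) * (norm h)\<^sup>2"
      unfolding norm_diff_scaleR_sq[OF ip_S] by (simp add: left_diff_distrib)
    also have "\<dots> \<le> max 0 (1 - A / B) * (norm h)\<^sup>2"
      by (rule mult_right_mono) auto
    also have "\<dots> = (q * norm h)\<^sup>2"
      by (simp add: q_def power_mult_distrib)
    finally show ?thesis
      by (rule power2_le_imp_le) (simp add: q_def)
  qed
  define T where "T h = h - (1 / B) *\<^sub>R (S h - y)" for h
  have "\<exists>!h. T h = h"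
  proof (rule banach_fix_type)
    show "0 \<le> q" "q < 1"
      using AB by (auto simp: q_def)
    show "\<forall>h k. dist (T h) (T k) \<le> q * dist h k"
    proof (intro allI)
      fix h k
      have "T h - T k = (h - k) - (1 / B) *\<^sub>R S (h - k)"
        by (simp add: T_def S_diff[symmetric] algebra_simps)
      then show "dist (T h) (T k) \<le> q * dist h k"
        using contr[of "h - k"] by (simp add: dist_norm)
    qed
  qed
  then obtain h where "T h = h"
    by blast
  then have "S h = y"
    using AB by (simp add: T_def)
  then show ?thesis
    using that summable_sums[OF summ[of h]] by (simp add: S_def)
qed

subsection \<open>Removing vectors from a frame\<close>

lemma energy_remove:
  assumes "bessel B f"
  shows "summable (\<lambda>j. (norm (ip g ((f(i := 0)) j)))\<^sup>2)"
    and "energy f g = energy (f(i := 0)) g + (norm (ip g (f i)))\<^sup>2"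
proof -
  let ?d = "\<lambda>j. if j = i then (norm (ip g (f i)))\<^sup>2 else 0"
  have "(\<lambda>j. (norm (ip g (f j)))\<^sup>2) sums energy f g"
    unfolding energy_def by (rule summable_sums[OF bessel_summable[OF assms]])
  then have "(\<lambda>j. (norm (ip g (f j)))\<^sup>2 - ?d j) sums (energy f g - (norm (ip g (f i)))\<^sup>2)"
    by (rule sums_diff[OF _ sums_single])
  moreover have "(\<lambda>j. (norm (ip g (f j)))\<^sup>2 - ?d j) = (\<lambda>j. (norm (ip g ((f(i := 0)) j)))\<^sup>2)"
    by auto
  ultimately have *: "(\<lambda>j. (norm (ip g ((f(i := 0)) j)))\<^sup>2) sums (energy f g - (norm (ip g (f i)))\<^sup>2)"
    by simp
  then show "summable (\<lambda>j. (norm (ip g ((f(i := 0)) j)))\<^sup>2)"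
    by (rule sums_summable)
  show "energy f g = energy (f(i := 0)) g + (norm (ip g (f i)))\<^sup>2"
    using sums_unique[OF *] by (simp only: energy_def)
qed

lemma bessel_remove:
  assumes "bessel B f"
  shows "bessel B (f(i := 0))"
  unfolding bessel_def
proof (intro allI conjI)
  fix g
  show "summable (\<lambda>j. (norm (ip g ((f(i := 0)) j)))\<^sup>2)"
    by (rule energy_remove[OF assms])
  have "energy (f(i := 0)) g \<le> energy f g"
    using energy_remove(2)[OF assms, of g i] by simp
  then show "energy (f(i := 0)) g \<le> B * (norm g)\<^sup>2"
    using bessel_energy_le[OF assms, of g] by linarith
qed

lemma energy_smul:
  assumes "bessel B f"
  shows "energy f (smul c g) = (norm c)\<^sup>2 * energy f g"
  unfolding energy_def
  by (simp add: ip_smul_left norm_mult power_mult_distrib suminf_mult[OF bessel_summable[OF assms]])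

lemma energy_diff_le:
  assumes "bessel B f"
  shows "energy f (g - h) \<le> 2 * energy f g + 2 * energy f h"
proof -
  note summ = bessel_summable[OF assms]
  have "(norm (a - b))\<^sup>2 \<le> 2 * (norm a)\<^sup>2 + 2 * (norm b)\<^sup>2" for a b :: 'k
  proof -
    have "(norm (a - b))\<^sup>2 \<le> (norm a + norm b)\<^sup>2"
      by (intro power_mono norm_triangle_ineq4) simp
    also have "\<dots> \<le> 2 * (norm a)\<^sup>2 + 2 * (norm b)\<^sup>2"
      using sum_squares_bound[of "norm a" "norm b"] by (simp add: power2_sum)
    finally show ?thesis .
  qed
  then have "energy f (g - h) \<le> (\<Sum>j. 2 * (norm (ip g (f j)))\<^sup>2 + 2 * (norm (ip h (f j)))\<^sup>2)"
    unfolding energy_def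
    by (intro suminf_le summable_add summable_mult summ) (simp add: ip_diff_left)
  also have "\<dots> = 2 * energy f g + 2 * energy f h"
    unfolding energy_def
    by (simp add: suminf_add[symmetric] suminf_mult summable_mult summ)
  finally show ?thesis .
qed

text \<open>A quantitative form of totality: the remaining coefficients control the removed
  one.\<close>

lemma removed_coefficient_bound:
  assumes "frame_seq f" and total: "\<And>g. (\<And>j. j \<noteq> i \<Longrightarrow> ip g (f j) = 0) \<Longrightarrow> g = 0"
  obtains C where "C > 0" "\<And>g. (norm (ip g (f i)))\<^sup>2 \<le> C * energy (f(i := 0)) g"
proof (rule ccontr)
  note that_C = that
  assume no_bound: "\<not> thesis"
  obtain A B where AB: "A > 0" "B > 0" and B: "bessel B f"
    and A: "\<And>g. A * (norm g)\<^sup>2 \<le> energy f g"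
    using \<open>frame_seq f\<close> unfolding frame_seq_def by blast
  let ?E = "energy (f(i := 0))"
  note B' = bessel_remove[OF B, of i]
  \<comment> \<open>A vector violating the bound with constant \<open>Suc n\<close> is rescaled so
    that its coefficient at \<open>i\<close> is 1.\<close>
  have "\<exists>h. ip h (f i) = 1 \<and> ?E h < 1 / real (Suc n)" for n
  proof -
    obtain g where g: "\<not> (norm (ip g (f i)))\<^sup>2 \<le> real (Suc n) * ?E g"
      using that_C[of "real (Suc n)"] no_bound by auto
    have "0 \<le> ?E g"
      unfolding energy_def by (intro suminf_nonneg bessel_summable[OF B']) simp
    then have nz: "ip g (f i) \<noteq> 0"
      using g by auto
    have "?E (smul (1 / ip g (f i)) g) = ?E g / (norm (ip g (f i)))\<^sup>2"
      by (simp add: energy_smul[OF B'] norm_divide power_divide)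
    also have "\<dots> < 1 / real (Suc n)"
      using g nz by (simp add: field_simps del: of_nat_Suc)
    finally show ?thesis
      using nz by (intro exI[of _ "smul (1 / ip g (f i)) g"]) (simp add: ip_smul_left)
  qed
  then obtain h where h1: "\<And>n. ip (h n) (f i) = 1" and hE: "\<And>n. ?E (h n) < 1 / real (Suc n)"
    by metis
  have "Cauchy h"
  proof (rule CauchyI)
    fix e :: real assume "e > 0"
    then have "A * e\<^sup>2 / 4 > 0"
      using AB by simp
    then obtain N where N: "inverse (real (Suc N)) < A * e\<^sup>2 / 4"
      using reals_Archimedean by blast
    \<comment> \<open>The quarter pays for the factor 2 on each of the two energies in
      \<open>energy_diff_le\<close>.\<close>
    have small: "?E (h n) < A * e\<^sup>2 / 4" if "n \<ge> N" for n
    proof -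
      have "1 / real (Suc n) \<le> inverse (real (Suc N))"
        using that by (simp add: field_simps)
      then show ?thesis
        using hE[of n] N by linarith
    qed
    have "norm (h m - h n) < e" if "m \<ge> N" "n \<ge> N" for m n
    proof -
      \<comment> \<open>The coefficients at \<open>i\<close> are all 1 and cancel in the difference,
        so its full and reduced energies agree.\<close>
      have "A * (norm (h m - h n))\<^sup>2 \<le> ?E (h m - h n)"
        using A[of "h m - h n"] energy_remove(2)[OF B, of "h m - h n" i]
        by (simp add: ip_diff_left h1)
      also have "\<dots> < A * e\<^sup>2"
        using energy_diff_le[OF B', of "h m" "h n"] small[OF that(1)] small[OF that(2)] by linarith
      finally have "(norm (h m - h n))\<^sup>2 < e\<^sup>2"
        using AB by simp
      then show ?thesis
        by (rule power2_less_imp_less) (use \<open>e > 0\<close> in simp)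
    qed
    then show "\<exists>N. \<forall>m\<ge>N. \<forall>n\<ge>N. norm (h m - h n) < e"
      by blast
  qed
  then obtain l where l: "h \<longlonglongrightarrow> l"
    using Cauchy_convergent convergent_def by blast
  have ip_lim: "(\<lambda>n. ip (h n) x) \<longlonglongrightarrow> ip l x" for x
    by (rule bounded_linear.tendsto[OF bounded_linear_ip_left l])
  have "ip l (f j) = 0" if "j \<noteq> i" for j
  proof -
    have "(norm (ip (h n) (f j)))\<^sup>2 \<le> 1 / real (Suc n)" for n
      using sum_le_energy[OF B', of "{j}" "h n"] hE[of n] that by simp
    then have "(norm (ip l (f j)))\<^sup>2 \<le> 0"
      by (intro LIMSEQ_le[OF tendsto_power[OF tendsto_norm[OF ip_lim]] LIMSEQ_inverse_real_of_nat])
         (auto simp: inverse_eq_divide)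
    then show ?thesis
      by simp
  qed
  then have "l = 0"
    by (rule total)
  \<comment> \<open>The coefficients at \<open>i\<close> are constantly 1, yet by continuity they
    tend to that of \<open>l = 0\<close>.\<close>
  then show False
    using ip_lim[of "f i"] by (simp add: h1 LIMSEQ_const_iff)
qed

text \<open>The removed coefficient costs at most \<open>C\<close> times the remaining energy, so
  the lower bound drops only to \<open>A / (1 + C)\<close>.\<close>

lemma frame_seq_remove:
  assumes "frame_seq f" and total: "\<And>g. (\<And>j. j \<noteq> i \<Longrightarrow> ip g (f j) = 0) \<Longrightarrow> g = 0"
  shows "frame_seq (f(i := 0))"
proof -
  obtain A B where AB: "A > 0" "B > 0" and B: "bessel B f"
    and A: "\<And>g. A * (norm g)\<^sup>2 \<le> energy f g"
    using \<open>frame_seq f\<close> unfolding frame_seq_def by blast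
  obtain C where C: "C > 0" "\<And>g. (norm (ip g (f i)))\<^sup>2 \<le> C * energy (f(i := 0)) g"
    using removed_coefficient_bound[OF assms] by blast
  have "A / (1 + C) * (norm g)\<^sup>2 \<le> energy (f(i := 0)) g" for g
  proof -
    have "A * (norm g)\<^sup>2 \<le> (1 + C) * energy (f(i := 0)) g"
      using A[of g] energy_remove(2)[OF B, of g i] C(2)[of g] by (simp add: algebra_simps)
    then show ?thesis
      using C(1) by (simp add: field_simps)
  qed
  moreover have "A / (1 + C) > 0"
    using AB C(1) by simp
  ultimately show ?thesis
    unfolding frame_seq_def using AB bessel_remove[OF B] by blast
qed

text \<open>Totality of the vectors outside \<open>insert i \<Lambda>\<close> implies totality of
  those outside \<open>\<Lambda>\<close>, so the induction hypothesis applies before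
  \<open>f i\<close> is removed.\<close>

lemma frame_seq_remove_finite:
  assumes "finite \<Lambda>" "frame_seq f"
    and "\<And>g. (\<And>j. j \<notin> \<Lambda> \<Longrightarrow> ip g (f j) = 0) \<Longrightarrow> g = 0"
  shows "frame_seq (\<lambda>j. if j \<in> \<Lambda> then 0 else f j)"
  using assms
proof (induction \<Lambda> rule: finite_induct)
  case empty
  then show ?case by simp
next
  case (insert i \<Lambda>)
  let ?f = "\<lambda>j. if j \<in> \<Lambda> then 0 else f j"
  have "frame_seq ?f"
    using insert.IH insert.prems by (metis insertCI)
  moreover have "g = 0" if "\<And>j. j \<noteq> i \<Longrightarrow> ip g (?f j) = 0" for g
    by (rule insert.prems(2)) (use that in force)
  ultimately have "frame_seq (?f(i := 0))"
    by (rule frame_seq_remove)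
  moreover have "?f(i := 0) = (\<lambda>j. if j \<in> insert i \<Lambda> then 0 else f j)"
    by auto
  ultimately show ?case by simp
qed

section \<open>Expansions of the removed vectors versus the frame property\<close>

lemma frame_seq_total:
  assumes "frame_seq f" "\<And>j. ip g (f j) = 0"
  shows "g = 0"
proof -
  obtain A where "A > 0" "A * (norm g)\<^sup>2 \<le> energy f g"
    using assms(1) unfolding frame_seq_def by blast
  then show ?thesis
    by (simp add: energy_def assms(2) mult_le_0_iff)
qed

lemma orthogonal_sums:
  assumes "v sums x" "\<And>j. ip g (v j) = 0"
  shows "ip g x = 0"
  using bounded_linear.sums[OF bounded_linear_ip_right assms(1), of g] assms(2)
  by (simp add: sums_iff)

text \<open>The equivalence holds for each \<open>\<Lambda>\<close> separately. Forwards, a vector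
  orthogonal to the remaining family is orthogonal to the removed vectors by continuity, hence zero.
  Backwards, the frame operator of the remaining family supplies the coefficients.\<close>

lemma expansions_iff_frame_seq_remove:
  assumes "finite \<Lambda>" "frame_seq f"
  shows "(\<exists>a. \<forall>i\<in>\<Lambda>. (\<lambda>j. if j \<in> \<Lambda> then 0 else smul (a i j) (f j)) sums f i)
    \<longleftrightarrow> frame_seq (\<lambda>j. if j \<in> \<Lambda> then 0 else f j)"
    (is "_ \<longleftrightarrow> frame_seq ?f")
proof
  assume "\<exists>a. \<forall>i\<in>\<Lambda>. (\<lambda>j. if j \<in> \<Lambda> then 0 else smul (a i j) (f j)) sums f i"
  then obtain a where a: "\<And>i. i \<in> \<Lambda> \<Longrightarrow> (\<lambda>j. if j \<in> \<Lambda> then 0 else smul (a i j) (f j)) sums f i"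
    by blast
  show "frame_seq ?f"
  proof (rule frame_seq_remove_finite[OF assms])
    fix g assume g: "\<And>j. j \<notin> \<Lambda> \<Longrightarrow> ip g (f j) = 0"
    then have "ip g (f j) = 0" if "j \<in> \<Lambda>" for j
      by (intro orthogonal_sums[OF a[OF that]]) (simp add: ip_smul_right)
    with g have "ip g (f j) = 0" for j
      by blast
    then show "g = 0"
      by (rule frame_seq_total[OF assms(2)])
  qed
next
  assume "frame_seq ?f"
  then have "\<exists>h. (\<lambda>j. smul (ip h (?f j)) (?f j)) sums f i" for i
    using frame_seq_expansion by blast
  then obtain h where h: "\<And>i. (\<lambda>j. smul (ip (h i) (?f j)) (?f j)) sums f i"
    by metis
  \<comment> \<open>At indices in \<open>\<Lambda>\<close> the vector \<open>?f j\<close> is zero,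
    so the frame expansion is already padded as required.\<close>
  have "(\<lambda>j. if j \<in> \<Lambda> then 0 else smul (ip (h i) (f j)) (f j))
      = (\<lambda>j. smul (ip (h i) (?f j)) (?f j))" for i
    by (auto simp: fun_eq_iff)
  then show "\<exists>a. \<forall>i\<in>\<Lambda>. (\<lambda>j. if j \<in> \<Lambda> then 0 else smul (a i j) (f j)) sums f i"
    using h by (intro exI[of _ "\<lambda>i j. ip (h i) (f j)"]) simp
qed

end

theorem proposition4p5:
  fixes smul :: "'k::rc_field \<Rightarrow> 'h::banach \<Rightarrow> 'h"
    and ip :: "'h \<Rightarrow> 'h \<Rightarrow> 'k"
    and f :: "nat \<Rightarrow> 'h"
    and m :: nat
  assumes "hilbert_space smul ip"
    and "is_frame ip UNIV f"
    and "m \<ge> 1"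
  shows "has_excess smul f m \<longleftrightarrow>
    (\<forall>\<Lambda> :: nat set. finite \<Lambda> \<and> card \<Lambda> = m \<longrightarrow> is_frame ip (UNIV - \<Lambda>) f)"
proof -
  interpret hilbert_space smul ip by fact
  have "frame_seq f"
    using assms(2) by (simp only: is_frame_UNIV_iff)
  then show ?thesis
    unfolding has_excess_def is_frame_Compl_iff
    using expansions_iff_frame_seq_remove by blast
qed

end
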